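(* Let $n\ge2$ be an even integer. (1) If $n\in\{2,4,6\}$, then for every positive-definite $n\times n$ matrix $A$ and every $t>0$ the weak $\chi^2$ bound is sharper than the $m_\infty$ bound, i.e. $$1-F_{\chi^2_n}\Big(1+\frac{t}{\|A\|}\Big)<\Big(1+\frac{t}{n\|A\|}\Big)^{\frac n2}e^{-\frac{t}{2\|A\|}}.$$ (2) If $n\ge8$, there exist positive constants $r_n,r_n'$ (depending only on $n$) with $r_n<1<r_n'$ such that for every positive-definite $n\times n$ matrix $A$ and every $t>0$ the $m_\infty$ bound is sharper than the weak $\chi^2$ bound, i.e. $$\Big(1+\frac{t}{n\|A\|}\Big)^{\frac n2}e^{-\frac{t}{2\|A\|}}<1-F_{\chi^2_n}\Big(1+\frac{t}{\|A\|}\Big),$$ if and only if $r_n<\frac{t}{\|A\|}<r_n'$.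
   Context: $\|A\|$ is the operator norm and $F_{\chi^2_n}$ is the CDF of a $\chi^2$ random variable with $n$ degrees of freedom; for even $n$, $F_{\chi^2_n}(x)=1-e^{-x/2}\sum_{i=0}^{n/2-1}\frac{x^i}{2^i i!}$ for $x\ge0$. *)

theory Defs
  imports "HOL-Probability.Probability"
begin

definition chi_square_distribution :: "nat \<Rightarrow> real measure" where
  "chi_square_distribution n =
     distr (Pi\<^sub>M {..<n} (\<lambda>_. std_normal_distribution)) borel (\<lambda>x. \<Sum>i<n. (x i)\<^sup>2)"

definition chi_square_cdf :: "nat \<Rightarrow> real \<Rightarrow> real" where
  "chi_square_cdf n = cdf (chi_square_distribution n)"

definition positive_definite :: "real ^ 'n ^ 'n \<Rightarrow> bool" where
  "positive_definite A \<longleftrightarrow> transpose A = A \<and> (\<forall>x. x \<noteq> 0 \<longrightarrow> x \<bullet> (A *v x) > 0)"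

text \<open>The norm that the vector type provides on \<^typ>\<open>real ^ 'n ^ 'n\<close> is the Frobenius norm.\<close>

definition op_norm :: "real ^ 'n ^ 'n \<Rightarrow> real" where
  "op_norm A = onorm ((*v) A)"

end

theory Submission
  imports Defs "HOL-Real_Asymp.Real_Asymp"
begin

text \<open>
  Write \<open>n = 2 m\<close> and \<open>x = (1 + t / \<parallel>A\<parallel>) / 2\<close>, so that \<open>t > 0\<close> means \<open>x > 1 / 2\<close>. The
  \<open>\<chi>\<^sup>2\<close> tail is \<open>exp (- x)\<close> times the Taylor polynomial \<open>exp_sum m x\<close> of the exponential
  function, by \<open>chi_square_tail\<close>; hence the \<open>m\<^sub>\<infinity>\<close> bound minus the weak \<open>\<chi>\<^sup>2\<close> bound is
  \<open>exp (- x)\<close> times a polynomial \<open>gap m x\<close>, and everything is about its sign on \<open>x > 1 / 2\<close>.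

  For \<open>m \<le> 3\<close> the coefficients of \<open>gap m (u + 1 / 2)\<close> in \<open>u\<close> are all positive. For \<open>m \<ge> 4\<close> the
  gap is positive at \<open>x = 1 / 2\<close>, nonnegative for large \<open>x\<close>, and negative at \<open>x = 1\<close>
  (\<open>gap_at_one_neg\<close>), where for large \<open>m\<close> it is about \<open>- exp 1 / (8 m)\<close>. It remains to see that
  the set where it is negative has no holes (\<open>gap_neg_between\<close>): an open, bounded interval
  around \<open>t / \<parallel>A\<parallel> = 1\<close>, away from 0, is \<open>(r, r')\<close> with \<open>0 < r < 1 < r'\<close>.

  For the last point, compare the two bounds by the logarithm of their ratio. Its derivative has
  the sign of a polynomial \<open>slope (m - 1)\<close> whose coefficients change sign only twice, in the
  pattern \<open>+ - ... - +\<close>. By the argument behind Descartes' rule of signs, this polynomial cannot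
  go from negative to nonnegative and back on \<open>x > 0\<close> (\<open>slope_stays_nonneg\<close>). A hole
  in the negative set would force the log ratio to fall, rise and fall again, hence exactly this.

  The tail formula comes from integrating the Gaussian density over the outside of a ball
  by layers: \<open>exp (- q / 2)\<close> is the integral of \<open>exp (- v / 2) / 2\<close> over \<open>v \<ge> q\<close>, so after Fubini
  only volumes of shells \<open>a < \<parallel>x\<parallel>\<^sup>2 \<le> v\<close> are needed, and these are differences of powers of \<open>v\<close>.
\<close>

section \<open>Taylor polynomials of the exponential function\<close>

definition exp_sum :: "nat \<Rightarrow> real \<Rightarrow> real" where
  "exp_sum k x = (\<Sum>i<k. x ^ i / fact i)"

lemma exp_sum_Suc: "exp_sum (Suc k) x = exp_sum k x + x ^ k / fact k"
  by (simp add: exp_sum_def)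

lemma exp_sum_0 [simp]: "exp_sum 0 x = 0"
  by (simp add: exp_sum_def)

lemma exp_sum_nonneg: "0 \<le> x \<Longrightarrow> 0 \<le> exp_sum k x"
  by (simp add: exp_sum_def sum_nonneg)

lemma exp_sum_pos: "0 \<le> x \<Longrightarrow> 0 < k \<Longrightarrow> 0 < exp_sum k x"
  unfolding exp_sum_def by (rule sum_pos2[of _ 0]) auto

lemma exp_sum_less_exp: "0 < x \<Longrightarrow> exp_sum k x < exp x"
proof (cases "k = 0")
  case False
  assume "0 < x"
  with False obtain t where "exp x = exp_sum k x + exp t / fact k * x ^ k"
    using Maclaurin_exp_lt[of x k] by (auto simp: exp_sum_def)
  with \<open>0 < x\<close> show ?thesis by simp
qed simp

lemma has_derivative_power_fact:
  "((\<lambda>x::real. x ^ Suc k / fact (Suc k)) has_real_derivative x ^ k / fact k) (at x)"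
  using DERIV_cdivide[OF DERIV_pow[of "Suc k" x], of "fact (Suc k)"] by (simp del: of_nat_Suc)

lemma has_derivative_exp_sum_Suc:
  "(exp_sum (Suc k) has_real_derivative exp_sum k x) (at x)"
proof (induction k)
  case 0
  show ?case by (simp add: exp_sum_def)
next
  case (Suc k)
  have "exp_sum (Suc (Suc k)) = (\<lambda>x. exp_sum (Suc k) x + x ^ Suc k / fact (Suc k))"
    by (rule ext) (rule exp_sum_Suc)
  moreover note DERIV_add[OF Suc has_derivative_power_fact[of k x]]
  ultimately show ?case by (simp only: exp_sum_Suc[of k])
qed

section \<open>The tail of the chi-square distribution\<close>

lemma PiM_density_lborel:
  fixes f :: "'i \<Rightarrow> real \<Rightarrow> ennreal"
  assumes "finite I" and f[measurable]: "\<And>i. f i \<in> borel_measurable borel"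
    and sf: "\<And>i. sigma_finite_measure (density lborel (f i))"
  shows "Pi\<^sub>M I (\<lambda>i. density lborel (f i)) = density (Pi\<^sub>M I (\<lambda>_. lborel)) (\<lambda>x. \<Prod>i\<in>I. f i (x i))"
proof -
  interpret D: product_sigma_finite "\<lambda>i. density lborel (f i)"
    using sf by (simp add: product_sigma_finite_def)
  interpret L: product_sigma_finite "\<lambda>_::'i. lborel :: real measure"
    by standard
  show ?thesis
  proof (rule D.PiM_eqI[OF \<open>finite I\<close>, symmetric])
    show "sets (density (Pi\<^sub>M I (\<lambda>_. lborel)) (\<lambda>x. \<Prod>i\<in>I. f i (x i)))
        = sets (Pi\<^sub>M I (\<lambda>i. density lborel (f i)))"
      by (simp cong: sets_PiM_cong)
    fix A :: "'i \<Rightarrow> real set"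
    assume "\<And>i. i \<in> I \<Longrightarrow> A i \<in> sets (density lborel (f i))"
    then have A[measurable]: "\<And>i. i \<in> I \<Longrightarrow> A i \<in> sets lborel" by simp
    have PA: "Pi\<^sub>E I A \<in> sets (Pi\<^sub>M I (\<lambda>_. lborel))"
      using \<open>finite I\<close> A by (intro sets_PiM_I_finite) auto
    have "emeasure (density (Pi\<^sub>M I (\<lambda>_. lborel)) (\<lambda>x. \<Prod>i\<in>I. f i (x i))) (Pi\<^sub>E I A)
        = (\<integral>\<^sup>+x. (\<Prod>i\<in>I. f i (x i)) * indicator (Pi\<^sub>E I A) x \<partial>Pi\<^sub>M I (\<lambda>_. lborel))"
      by (intro emeasure_density PA) measurable
    also have "\<dots> = (\<integral>\<^sup>+x. (\<Prod>i\<in>I. f i (x i) * indicator (A i) (x i)) \<partial>Pi\<^sub>M I (\<lambda>_. lborel))"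
      using \<open>finite I\<close>
      by (intro nn_integral_cong)
        (auto simp: prod.distrib indicator_def space_PiM PiE_iff prod_eq_1_iff intro!: prod_zero[symmetric])
    also have "\<dots> = (\<Prod>i\<in>I. \<integral>\<^sup>+y. f i y * indicator (A i) y \<partial>lborel)"
      using \<open>finite I\<close> A by (intro L.product_nn_integral_prod) auto
    also have "\<dots> = (\<Prod>i\<in>I. emeasure (density lborel (f i)) (A i))"
      using A by (intro prod.cong refl) (simp add: emeasure_density)
    finally show "emeasure (density (Pi\<^sub>M I (\<lambda>_. lborel)) (\<lambda>x. \<Prod>i\<in>I. f i (x i))) (Pi\<^sub>E I A)
        = (\<Prod>i\<in>I. emeasure (density lborel (f i)) (A i))" .
  qed
qed

abbreviation sq_norm :: "nat \<Rightarrow> (nat \<Rightarrow> real) \<Rightarrow> real" where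
  "sq_norm n x \<equiv> \<Sum>i<n. (x i)\<^sup>2"

lemma prod_std_normal_density:
  "(\<Prod>i<2 * m. std_normal_density (x i)) = exp (- sq_norm (2 * m) x / 2) / (2 * pi) ^ m"
proof -
  have "(\<Prod>i<2 * m. std_normal_density (x i)) = (1 / sqrt (2 * pi)) ^ (2 * m) * exp (\<Sum>i<2 * m. - (x i)\<^sup>2 / 2)"
    by (simp add: std_normal_density_def prod.distrib exp_sum prod_dividef power_one_over)
  also have "(1 / sqrt (2 * pi)) ^ (2 * m) = 1 / (2 * pi) ^ m"
    by (simp only: power_mult) (simp add: power_divide)
  finally show ?thesis by (simp add: sum_negf sum_divide_distrib)
qed

text \<open>A shell is a difference of two balls, and the volume of a ball of even dimension \<open>2 m\<close> and
  squared radius \<open>v\<close> is the polynomial \<open>\<pi> ^ m * v ^ m / m!\<close>.\<close>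

lemma emeasure_shell:
  assumes "0 < a" "a \<le> b"
  shows "emeasure (Pi\<^sub>M {..<2 * m} (\<lambda>_. lborel))
      {x \<in> space (Pi\<^sub>M {..<2 * m} (\<lambda>_. lborel)). a < sq_norm (2 * m) x \<and> sq_norm (2 * m) x \<le> b}
    = ennreal (pi ^ m / fact m * (b ^ m - a ^ m))"
proof -
  let ?P = "Pi\<^sub>M {..<2 * m} (\<lambda>_. lborel) :: (nat \<Rightarrow> real) measure"
  let ?B = "\<lambda>v. {x \<in> space ?P. sq_norm (2 * m) x \<le> v}"
  have ball: "emeasure ?P (?B v) = ennreal (pi ^ m / fact m * v ^ m)" if "0 < v" for v
  proof -
    have "?B v = {x. sqrt (sq_norm (2 * m) x) \<le> sqrt v} \<inter> space ?P" by auto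
    moreover have "sqrt v ^ (2 * m) = v ^ m" using that by (simp add: power_mult)
    ultimately show ?thesis
      using emeasure_cball_aux[of "{..<2 * m}" "sqrt v"] unit_ball_vol_even[of m] that by simp
  qed
  have "{x \<in> space ?P. a < sq_norm (2 * m) x \<and> sq_norm (2 * m) x \<le> b} = ?B b - ?B a" by auto
  moreover have "emeasure ?P (?B b - ?B a) = emeasure ?P (?B b) - emeasure ?P (?B a)"
    using assms by (intro emeasure_Diff) (auto simp: ball)
  ultimately show ?thesis
    using assms by (simp add: ball ennreal_minus right_diff_distrib)
qed

text \<open>The layered form of the tail: \<open>v ^ m - a ^ m\<close> is the volume of the shell up to level \<open>v\<close>, without
  its constant. The power \<open>v ^ m\<close> alone contributes the Taylor polynomial up to degree \<open>m\<close>, and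
  subtracting \<open>a ^ m\<close> removes its top term.\<close>

lemma tail_integral:
  fixes a :: real
  assumes "0 < a"
  shows "(\<integral>\<^sup>+v. ennreal (exp (- v / 2) / 2 * (v ^ m - a ^ m)) * indicator {a..} v \<partial>lborel)
    = ennreal (fact m * 2 ^ m * (exp (- a / 2) * exp_sum m (a / 2)))"
proof -
  define E :: "real \<Rightarrow> real" where "E w = exp (- w) * exp_sum (Suc m) w" for w
  define F where "F v = a ^ m * exp (- v / 2) - fact m * 2 ^ m * E (v / 2)" for v
  (* The derivative of exp_sum (Suc m) loses exactly its top term, which is all that survives here. *)
  have dE: "(E has_real_derivative - (exp (- w) * w ^ m / fact m)) (at w)" for w
  proof -
    have "((\<lambda>w::real. exp (- w)) has_real_derivative - exp (- w)) (at w)"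
      by (auto intro!: derivative_eq_intros)
    then show ?thesis
      unfolding E_def
      by (rule DERIV_cong[OF DERIV_mult[OF _ has_derivative_exp_sum_Suc]])
         (simp add: exp_sum_Suc algebra_simps)
  qed
  have dF: "(F has_real_derivative exp (- v / 2) / 2 * (v ^ m - a ^ m)) (at v)" for v
    unfolding F_def
    by (rule derivative_eq_intros refl DERIV_chain2[OF dE] | simp)+
       (simp add: field_simps)
  have "((\<lambda>w. w ^ i / exp w) \<longlongrightarrow> (0::real)) at_top" for i
    by (rule tendsto_power_div_exp_0)
  then have "((\<lambda>w::real. \<Sum>i<Suc m. (w ^ i / exp w) / fact i) \<longlongrightarrow> (\<Sum>i<Suc m. 0 / fact i)) at_top"
    by (intro tendsto_intros) auto
  then have "(E \<longlongrightarrow> 0) at_top"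
    unfolding E_def exp_sum_def
    by (simp add: exp_minus field_simps sum_distrib_left sum_distrib_right sum_divide_distrib del: sum.lessThan_Suc)
  then have "((\<lambda>v. E (v / 2)) \<longlongrightarrow> 0) at_top"
    by (rule filterlim_compose) real_asymp
  moreover have "((\<lambda>v::real. exp (- v / 2)) \<longlongrightarrow> 0) at_top" by real_asymp
  ultimately have "(F \<longlongrightarrow> a ^ m * 0 - fact m * 2 ^ m * 0) at_top"
    unfolding F_def by (intro tendsto_intros)
  then have lim: "(F \<longlongrightarrow> 0) at_top" by simp
  have Fa: "0 - F a = fact m * 2 ^ m * (exp (- a / 2) * exp_sum m (a / 2))"
    unfolding F_def E_def by (simp add: exp_sum_Suc algebra_simps power_divide)
  show ?thesis
    unfolding Fa[symmetric]
    using assms dF lim by (intro nn_integral_FTC_atLeast) (auto intro!: mult_nonneg_nonneg power_mono)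
qed

lemma exp_layer_cake:
  "ennreal (exp (- q / 2)) = (\<integral>\<^sup>+v. ennreal (exp (- v / 2) / 2) * indicator {q..} v \<partial>lborel)"
proof -
  have "((\<lambda>v::real. - exp (- v / 2)) \<longlongrightarrow> 0) at_top" by real_asymp
  then have "(\<integral>\<^sup>+v. ennreal (exp (- v / 2) / 2) * indicator {q..} v \<partial>lborel) = ennreal (0 - - exp (- q / 2))"
    by (intro nn_integral_FTC_atLeast) (auto intro!: derivative_eq_intros)
  then show ?thesis by simp
qed

text \<open>Replacing the density by the integral over its layers \<open>v\<close> and exchanging the integrals leaves,
  for each \<open>v\<close>, the volume of a shell; this avoids polar coordinates.\<close>

lemma gaussian_outside_ball:
  assumes "0 < a"
  shows "(\<integral>\<^sup>+x. ennreal (exp (- sq_norm (2 * m) x / 2)) * indicator {x. a < sq_norm (2 * m) x} x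
        \<partial>Pi\<^sub>M {..<2 * m} (\<lambda>_. lborel))
    = ennreal ((2 * pi) ^ m * (exp (- a / 2) * exp_sum m (a / 2)))"
proof -
  let ?P = "Pi\<^sub>M {..<2 * m} (\<lambda>_. lborel) :: (nat \<Rightarrow> real) measure"
  define q where "q = sq_norm (2 * m)"
  have [measurable]: "q \<in> borel_measurable ?P"
    unfolding q_def by measurable
  let ?shell = "\<lambda>v. {x \<in> space ?P. a < q x \<and> q x \<le> v}"
  interpret L: product_sigma_finite "\<lambda>_::nat. lborel :: real measure" by standard
  interpret P: sigma_finite_measure ?P by (rule L.sigma_finite) simp
  interpret PL: pair_sigma_finite ?P "lborel :: real measure" ..
  have "(\<integral>\<^sup>+x. ennreal (exp (- q x / 2)) * indicator {x. a < q x} x \<partial>?P)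
    = (\<integral>\<^sup>+x. (\<integral>\<^sup>+v. ennreal (exp (- v / 2) / 2) * indicator {a..} v *
          (if a < q x \<and> q x \<le> v then 1 else 0) \<partial>lborel) \<partial>?P)"
    unfolding exp_layer_cake
    by (intro nn_integral_cong) (auto simp: indicator_def intro!: nn_integral_cong)
  also have "\<dots> = (\<integral>\<^sup>+v. (\<integral>\<^sup>+x. ennreal (exp (- v / 2) / 2) * indicator {a..} v *
          (if a < q x \<and> q x \<le> v then 1 else 0) \<partial>?P) \<partial>lborel)"
    by (rule PL.Fubini'[symmetric]) measurable
  also have "\<dots> = (\<integral>\<^sup>+v. ennreal (exp (- v / 2) / 2) * indicator {a..} v * emeasure ?P (?shell v) \<partial>lborel)"
  proof (intro nn_integral_cong)
    fix v :: real
    have "(\<integral>\<^sup>+x. ennreal (exp (- v / 2) / 2) * indicator {a..} v * (if a < q x \<and> q x \<le> v then 1 else 0) \<partial>?P)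
      = (\<integral>\<^sup>+x. ennreal (exp (- v / 2) / 2) * indicator {a..} v * indicator (?shell v) x \<partial>?P)"
      by (intro nn_integral_cong) (auto simp: indicator_def)
    also have "\<dots> = ennreal (exp (- v / 2) / 2) * indicator {a..} v * emeasure ?P (?shell v)"
      by (intro nn_integral_cmult_indicator) measurable
    finally show "(\<integral>\<^sup>+x. ennreal (exp (- v / 2) / 2) * indicator {a..} v * (if a < q x \<and> q x \<le> v then 1 else 0) \<partial>?P)
      = ennreal (exp (- v / 2) / 2) * indicator {a..} v * emeasure ?P (?shell v)" .
  qed
  also have "\<dots> = (\<integral>\<^sup>+v. ennreal (pi ^ m / fact m) *
      (ennreal (exp (- v / 2) / 2 * (v ^ m - a ^ m)) * indicator {a..} v) \<partial>lborel)"
  proof (intro nn_integral_cong)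
    fix v :: real
    show "ennreal (exp (- v / 2) / 2) * indicator {a..} v * emeasure ?P (?shell v)
      = ennreal (pi ^ m / fact m) * (ennreal (exp (- v / 2) / 2 * (v ^ m - a ^ m)) * indicator {a..} v)"
    proof (cases "a \<le> v")
      case True
      then have "emeasure ?P (?shell v) = ennreal (pi ^ m / fact m * (v ^ m - a ^ m))"
        unfolding q_def using assms by (intro emeasure_shell)
      with True show ?thesis by (simp add: ennreal_mult'[symmetric] mult_ac)
    qed simp
  qed
  also have "\<dots> = ennreal (pi ^ m / fact m) *
      ennreal (fact m * 2 ^ m * (exp (- a / 2) * exp_sum m (a / 2)))"
    by (subst nn_integral_cmult) (measurable, simp only: tail_integral[OF assms])
  also have "\<dots> = ennreal ((2 * pi) ^ m * (exp (- a / 2) * exp_sum m (a / 2)))"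
    by (subst ennreal_mult'[symmetric]) (simp_all add: power_mult_distrib mult_ac)
  finally show ?thesis unfolding q_def .
qed

lemma chi_square_tail:
  assumes "0 < a"
  shows "1 - chi_square_cdf (2 * m) a = exp (- a / 2) * exp_sum m (a / 2)"
proof -
  let ?P = "Pi\<^sub>M {..<2 * m} (\<lambda>_. lborel) :: (nat \<Rightarrow> real) measure"
  let ?N = "Pi\<^sub>M {..<2 * m} (\<lambda>_. std_normal_distribution) :: (nat \<Rightarrow> real) measure"
  let ?q = "sq_norm (2 * m)"
  let ?T = "exp (- a / 2) * exp_sum m (a / 2)"
  interpret N: prob_space ?N
    by (intro prob_space_PiM prob_space_normal_density) simp
  have sN: "sets ?N = sets ?P" by (simp cong: sets_PiM_cong)
  have q: "?q \<in> borel_measurable ?N"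
    unfolding measurable_cong_sets[OF sN refl] by measurable
  interpret C: prob_space "chi_square_distribution (2 * m)"
    unfolding chi_square_distribution_def using q by (rule N.prob_space_distr)
  have sN': "space ?N = space ?P" using sN by (rule sets_eq_imp_space_eq)
  have "?N = density ?P (\<lambda>x. \<Prod>i<2 * m. ennreal (std_normal_density (x i)))"
    by (intro PiM_density_lborel prob_space_imp_sigma_finite prob_space_normal_density) auto
  also have "\<dots> = density ?P (\<lambda>x. ennreal (exp (- ?q x / 2) / (2 * pi) ^ m))"
    by (simp add: prod_ennreal prod_std_normal_density)
  finally have N: "?N = density ?P (\<lambda>x. ennreal (exp (- ?q x / 2) / (2 * pi) ^ m))" .
  have "emeasure (chi_square_distribution (2 * m)) {a<..} = emeasure ?N {x \<in> space ?N. a < ?q x}"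
    unfolding chi_square_distribution_def using q
    by (subst emeasure_distr) (auto intro!: arg_cong2[where f = emeasure])
  also have "\<dots> = (\<integral>\<^sup>+x. ennreal (exp (- ?q x / 2) / (2 * pi) ^ m) * indicator {x \<in> space ?P. a < ?q x} x \<partial>?P)"
    unfolding sN' unfolding N by (intro emeasure_density) measurable
  also have "\<dots> = (\<integral>\<^sup>+x. ennreal (1 / (2 * pi) ^ m) *
      (ennreal (exp (- ?q x / 2)) * indicator {x. a < ?q x} x) \<partial>?P)"
    by (intro nn_integral_cong) (auto simp: indicator_def ennreal_mult'[symmetric])
  also have "\<dots> = ennreal (1 / (2 * pi) ^ m) * ennreal ((2 * pi) ^ m * ?T)"
    by (subst nn_integral_cmult) (measurable, simp only: gaussian_outside_ball[OF assms])
  also have "\<dots> = ennreal ?T"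
    by (subst ennreal_mult'[symmetric]) simp_all
  finally have "measure (chi_square_distribution (2 * m)) {a<..} = ?T"
    using assms by (simp add: measure_def exp_sum_nonneg)
  moreover have "measure (chi_square_distribution (2 * m)) {a<..} = 1 - measure (chi_square_distribution (2 * m)) {..a}"
  proof -
    have "space (chi_square_distribution (2 * m)) - {..a} = {a<..}"
      by (auto simp: chi_square_distribution_def)
    moreover have "{..a} \<in> sets (chi_square_distribution (2 * m))"
      by (simp add: chi_square_distribution_def)
    ultimately show ?thesis using C.prob_compl by metis
  qed
  ultimately show ?thesis by (simp add: chi_square_cdf_def cdf_def)
qed

section \<open>The sign pattern of the derivative of the log ratio\<close>

text \<open>For \<open>x > 1 / 2\<close> this has the sign of the derivative of \<open>log_ratio (Suc k)\<close> below. The coefficient of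
  \<open>x ^ i\<close> is \<open>(1 / 2 - i) / i!\<close> for \<open>i < k\<close>, and for \<open>k > 0\<close> the top coefficient, that of
  \<open>x ^ k\<close>, is \<open>1 / k!\<close>.\<close>

definition slope :: "nat \<Rightarrow> real \<Rightarrow> real" where
  "slope k x = (1 / 2 - x) * exp_sum k x + Suc k * (x ^ k / fact k)"

lemma has_derivative_slope:
  "(slope (Suc j) has_real_derivative Suc j * (x ^ j / fact j) - (1 / 2 + x) * exp_sum j x) (at x)"
proof -
  have "((\<lambda>x. (1 / 2 - x) * exp_sum (Suc j) x + Suc (Suc j) * (x ^ Suc j / fact (Suc j))) has_real_derivative
     - 1 * exp_sum (Suc j) x + exp_sum j x * (1 / 2 - x) + Suc (Suc j) * (x ^ j / fact j)) (at x)"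
    by (intro DERIV_add DERIV_mult DERIV_cmult has_derivative_power_fact has_derivative_exp_sum_Suc)
       (auto intro!: derivative_eq_intros)
  then show ?thesis
    unfolding slope_def[abs_def]
    by (rule DERIV_cong) (simp add: exp_sum_Suc algebra_simps add_divide_distrib)
qed

text \<open>The derivative of \<open>slope (Suc j)\<close>, divided by \<open>x ^ j\<close>, is a constant minus
  \<open>(1 / 2 + x) * exp_sum j x / x ^ j\<close>. The latter is a combination of nonpositive powers of \<open>x\<close> with
  nonnegative coefficients, so it can only decrease. The division is cleared below.\<close>

lemma slope_deriv_quotient_antimono:
  assumes "0 < x" "x \<le> y"
  shows "(1 / 2 + y) * exp_sum j y * x ^ j \<le> (1 / 2 + x) * exp_sum j x * y ^ j"
proof -
  have "(1 / 2 + y) * y ^ i * x ^ j \<le> (1 / 2 + x) * x ^ i * y ^ j" if "i < j" for i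
  proof -
    from that obtain d where j: "j = i + Suc d" using less_iff_Suc_add by auto
    have "(1 / 2 + y) * x ^ Suc d = 1 / 2 * x ^ Suc d + (x * y) * x ^ d" by (simp add: algebra_simps)
    also have "\<dots> \<le> 1 / 2 * y ^ Suc d + (x * y) * y ^ d"
      using assms by (intro add_mono mult_left_mono power_mono) auto
    also have "\<dots> = (1 / 2 + x) * y ^ Suc d" by (simp add: algebra_simps)
    finally have "(x * y) ^ i * ((1 / 2 + y) * x ^ Suc d) \<le> (x * y) ^ i * ((1 / 2 + x) * y ^ Suc d)"
      using assms by (intro mult_left_mono) auto
    then show ?thesis by (simp add: j power_add power_mult_distrib mult_ac)
  qed
  then have "(\<Sum>i<j. ((1 / 2 + y) * y ^ i * x ^ j) / fact i) \<le> (\<Sum>i<j. ((1 / 2 + x) * x ^ i * y ^ j) / fact i)"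
    by (intro sum_mono divide_right_mono) auto
  then show ?thesis
    by (simp add: exp_sum_def sum_distrib_left sum_distrib_right)
qed

text \<open>To rise from \<open>a\<close> to \<open>b\<close>, the function must have a positive derivative somewhere before \<open>b\<close>. By
  the preceding monotonicity the derivative stays nonnegative from there on.\<close>

lemma slope_stays_nonneg:
  assumes "0 < a" "a < b" "b \<le> d" and neg: "slope (Suc j) a < 0" and nonneg: "0 \<le> slope (Suc j) b"
  shows "0 \<le> slope (Suc j) d"
proof -
  define D where "D x = Suc j * (x ^ j / fact j) - (1 / 2 + x) * exp_sum j x" for x
  have dS: "(slope (Suc j) has_real_derivative D x) (at x)" for x
    unfolding D_def by (rule has_derivative_slope)
  obtain \<xi> where \<xi>: "a < \<xi>" "\<xi> < b" "slope (Suc j) b - slope (Suc j) a = (b - a) * D \<xi>"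
    using MVT2[of a b "slope (Suc j)" D] dS \<open>a < b\<close> by auto
  have "0 < (b - a) * D \<xi>" using \<xi>(3) neg nonneg by linarith
  then have D\<xi>: "0 < D \<xi>" using \<open>a < b\<close> by (simp add: zero_less_mult_iff)
  have D_nonneg: "0 \<le> D y" if "\<xi> \<le> y" for y
  proof -
    have "(1 / 2 + y) * exp_sum j y * \<xi> ^ j \<le> (1 / 2 + \<xi>) * exp_sum j \<xi> * y ^ j"
      using slope_deriv_quotient_antimono \<xi>(1) \<open>0 < a\<close> that by simp
    also have "\<dots> \<le> (Suc j * (\<xi> ^ j / fact j)) * y ^ j"
      using D\<xi> that \<xi>(1) \<open>0 < a\<close> by (intro mult_right_mono) (auto simp: D_def)
    finally have "(1 / 2 + y) * exp_sum j y * \<xi> ^ j \<le> (Suc j * (y ^ j / fact j)) * \<xi> ^ j"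
      by (simp add: mult_ac)
    then have "(1 / 2 + y) * exp_sum j y \<le> Suc j * (y ^ j / fact j)"
      by (rule mult_right_le_imp_le) (use \<xi>(1) \<open>0 < a\<close> in simp)
    then show ?thesis by (simp add: D_def)
  qed
  have "slope (Suc j) b \<le> slope (Suc j) d"
  proof (rule DERIV_nonneg_imp_nondecreasing[OF \<open>b \<le> d\<close>])
    fix x assume "b \<le> x"
    with \<xi>(2) have "0 \<le> D x" by (intro D_nonneg) simp
    with dS show "\<exists>y. (slope (Suc j) has_real_derivative y) (at x) \<and> 0 \<le> y" by blast
  qed
  with nonneg show ?thesis by linarith
qed

section \<open>The gap between the two bounds\<close>

text \<open>Up to the factor \<open>exp (- x)\<close>, the \<open>m\<^sub>\<infinity>\<close> bound minus the weak \<open>\<chi>\<^sup>2\<close> bound in dimension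
  \<open>2 m\<close>, at \<open>t / \<parallel>A\<parallel> = 2 x - 1\<close>.\<close>

definition gap :: "nat \<Rightarrow> real \<Rightarrow> real" where
  "gap m x = exp (1 / 2) * ((x + m - 1 / 2) / m) ^ m - exp_sum m x"

text \<open>The logarithm of the ratio of the two terms of \<open>gap m x\<close>.\<close>

definition log_ratio :: "nat \<Rightarrow> real \<Rightarrow> real" where
  "log_ratio m x = 1 / 2 + m * (ln (x + m - 1 / 2) - ln m) - ln (exp_sum m x)"

lemma log_ratio_neg_iff:
  assumes "1 / 2 \<le> x" "0 < m"
  shows "log_ratio m x < 0 \<longleftrightarrow> gap m x < 0"
proof -
  let ?L = "exp (1 / 2) * ((x + m - 1 / 2) / m) ^ m"
  have pos: "0 < x + m - 1 / 2" using assms by simp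
  have "ln ?L = 1 / 2 + m * (ln (x + m - 1 / 2) - ln m)"
    using pos assms by (simp add: ln_mult ln_realpow ln_div)
  then have "log_ratio m x = ln ?L - ln (exp_sum m x)" by (simp add: log_ratio_def)
  moreover have "0 < ?L" "0 < exp_sum m x" using pos assms by (auto intro: exp_sum_pos)
  ultimately show ?thesis using ln_less_cancel_iff[of ?L "exp_sum m x"] by (simp add: gap_def)
qed

lemma has_derivative_log_ratio:
  assumes "1 / 2 \<le> x"
  shows "(log_ratio (Suc k) has_real_derivative
     slope k x / ((x + k + 1 / 2) * exp_sum (Suc k) x)) (at x)"
proof -
  have pos: "0 < x + k + 1 / 2" "0 < exp_sum (Suc k) x" using assms by (auto intro: exp_sum_pos)
  have "((\<lambda>x. 1 / 2 + Suc k * (ln (x + k + 1 / 2) - ln (Suc k)) - ln (exp_sum (Suc k) x)) has_real_derivative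
    Suc k * (1 / (x + k + 1 / 2)) - exp_sum k x / exp_sum (Suc k) x) (at x)"
  proof -
    have "((\<lambda>x. ln (x + k + 1 / 2)) has_real_derivative 1 / (x + k + 1 / 2)) (at x)"
      using pos by (auto intro!: derivative_eq_intros)
    moreover have "((\<lambda>x. ln (exp_sum (Suc k) x)) has_real_derivative exp_sum k x / exp_sum (Suc k) x) (at x)"
      using DERIV_chain2[OF DERIV_ln_divide[OF pos(2)] has_derivative_exp_sum_Suc] by simp
    ultimately show ?thesis
      using DERIV_diff[OF DERIV_add[OF DERIV_const DERIV_cmult[OF DERIV_diff[OF _ DERIV_const]]]] by fastforce
  qed
  moreover have "log_ratio (Suc k) = (\<lambda>x::real. 1 / 2 + Suc k * (ln (x + k + 1 / 2) - ln (Suc k)) - ln (exp_sum (Suc k) x))"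
    by (rule ext) (simp add: log_ratio_def algebra_simps)
  moreover have "Suc k * (1 / (x + k + 1 / 2)) - exp_sum k x / exp_sum (Suc k) x
      = (Suc k * exp_sum (Suc k) x - exp_sum k x * (x + k + 1 / 2)) / ((x + k + 1 / 2) * exp_sum (Suc k) x)"
    using pos by (simp add: diff_frac_eq)
  moreover have "Suc k * exp_sum (Suc k) x - exp_sum k x * (x + k + 1 / 2) = slope k x"
    unfolding slope_def exp_sum_Suc by (simp add: algebra_simps)
  ultimately show ?thesis by simp
qed

lemma gap_at_half_pos: "0 < gap m (1 / 2)" if "0 < m"
  using exp_sum_less_exp[of "1 / 2" m] that by (simp add: gap_def)

text \<open>The mean value theorem, keeping only the sign of the derivative.\<close>

lemma log_ratio_MVT:
  assumes "1 / 2 \<le> a" "a < b"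
  obtains \<xi> where "a < \<xi>" "\<xi> < b" "log_ratio (Suc k) b < log_ratio (Suc k) a \<longleftrightarrow> slope k \<xi> < 0"
    "log_ratio (Suc k) a < log_ratio (Suc k) b \<longleftrightarrow> 0 < slope k \<xi>"
proof -
  obtain \<xi> where \<xi>: "a < \<xi>" "\<xi> < b" "log_ratio (Suc k) b - log_ratio (Suc k) a
      = (b - a) * (slope k \<xi> / ((\<xi> + k + 1 / 2) * exp_sum (Suc k) \<xi>))"
    using MVT2[of a b "log_ratio (Suc k)" "\<lambda>x. slope k x / ((x + k + 1 / 2) * exp_sum (Suc k) x)"]
      has_derivative_log_ratio assms by fastforce
  define c where "c = (b - a) / ((\<xi> + k + 1 / 2) * exp_sum (Suc k) \<xi>)"
  have "0 < c" unfolding c_def using \<xi> assms by (intro divide_pos_pos mult_pos_pos exp_sum_pos) auto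
  have "log_ratio (Suc k) b - log_ratio (Suc k) a = c * slope k \<xi>" using \<xi>(3) by (simp add: c_def)
  then have "log_ratio (Suc k) b < log_ratio (Suc k) a \<longleftrightarrow> c * slope k \<xi> < 0"
    "log_ratio (Suc k) a < log_ratio (Suc k) b \<longleftrightarrow> 0 < c * slope k \<xi>"
    by linarith+
  with \<open>0 < c\<close> have "log_ratio (Suc k) b < log_ratio (Suc k) a \<longleftrightarrow> slope k \<xi> < 0"
    "log_ratio (Suc k) a < log_ratio (Suc k) b \<longleftrightarrow> 0 < slope k \<xi>"
    by (simp_all add: mult_less_0_iff zero_less_mult_iff)
  with \<xi> that show thesis by blast
qed

text \<open>Otherwise the log ratio is negative at \<open>a\<close> and \<open>d\<close> and nonnegative at \<open>1 / 2\<close> and \<open>b\<close>, so it falls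
  before \<open>a\<close>, rises before \<open>b\<close> and falls after \<open>b\<close>. The slope would thus be negative, positive and
  negative again.\<close>

lemma gap_neg_between:
  assumes "2 \<le> m" "1 / 2 < a" "a < b" "b < d" and neg: "gap m a < 0" "gap m d < 0"
  shows "gap m b < 0"
proof (rule ccontr)
  assume "\<not> gap m b < 0"
  obtain j where m: "m = Suc (Suc j)" using \<open>2 \<le> m\<close> by (metis add_2_eq_Suc le_Suc_ex)
  have "log_ratio m a < 0" "log_ratio m d < 0" "0 \<le> log_ratio m b" "0 \<le> log_ratio m (1 / 2)"
    using log_ratio_neg_iff[of _ m] assms \<open>\<not> gap m b < 0\<close> gap_at_half_pos[of m] by (force simp: not_less[symmetric])+
  then have "log_ratio m a < log_ratio m (1 / 2)" "log_ratio m a < log_ratio m b" "log_ratio m d < log_ratio m b"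
    by linarith+
  note order = this[unfolded m]
  obtain x where x: "1 / 2 < x" "x < a" "slope (Suc j) x < 0"
    using log_ratio_MVT[of "1 / 2" a "Suc j"] order assms by auto
  obtain y where y: "a < y" "y < b" "0 < slope (Suc j) y"
    using log_ratio_MVT[of a b "Suc j"] order assms by auto
  obtain z where z: "b < z" "slope (Suc j) z < 0"
    using log_ratio_MVT[of b d "Suc j"] order assms by auto
  have "0 \<le> slope (Suc j) z"
    using x y z by (intro slope_stays_nonneg[of x y z]) auto
  with z show False by simp
qed

text \<open>The first term of the gap has degree \<open>m\<close> and the second only degree \<open>m - 1\<close>; the threshold is a
  crude explicit one.\<close>

lemma gap_nonneg_far:
  assumes "0 < m" "exp 1 * real m ^ m \<le> x"
  shows "0 \<le> gap m x"
proof -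
  obtain k where m: "m = Suc k" using assms(1) gr0_implies_Suc by blast
  have "1 \<le> real m ^ m" using assms(1) by (intro one_le_power) simp
  then have "1 * 1 \<le> exp 1 * real m ^ m" by (intro mult_mono) auto
  then have x: "1 \<le> x" using assms(2) by linarith
  have "exp_sum m x \<le> (\<Sum>i<m. x ^ k * (1 ^ i / fact i))"
    unfolding exp_sum_def using x m by (intro sum_mono) (auto intro!: divide_right_mono power_increasing)
  also have "\<dots> = x ^ k * exp_sum m 1" by (simp add: exp_sum_def sum_distrib_left)
  also have "\<dots> \<le> x ^ k * exp 1" using exp_sum_less_exp[of 1 m] x by (intro mult_left_mono) auto
  also have "\<dots> \<le> x ^ k * (x / real m ^ m)" using assms x
    by (intro mult_left_mono) (simp_all add: pos_le_divide_eq)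
  also have "\<dots> = 1 * (x / m) ^ m" by (simp add: m power_divide del: of_nat_Suc)
  also have "\<dots> \<le> exp (1 / 2) * ((x + m - 1 / 2) / m) ^ m"
    using x assms(1) by (intro mult_mono power_mono divide_right_mono) auto
  finally show ?thesis by (simp add: gap_def)
qed

lemma exp_half_less: "exp (1 / 2 :: real) < 208 / 125"
proof -
  obtain t :: real where t: "\<bar>t\<bar> < 1 / 2" "exp (1 / 2) = exp_sum 5 (1 / 2) + exp t / fact 5 * (1 / 2) ^ 5"
    using Maclaurin_exp_lt[of "1 / 2" 5] by (auto simp: exp_sum_def)
  have "exp t \<le> exp 1" using t by simp
  also have "\<dots> \<le> 3" by (rule exp_le)
  finally show ?thesis unfolding t(2) by (simp add: exp_sum_def eval_nat_numeral fact_numeral field_simps)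
qed

text \<open>A weak form of the second-order bound \<open>ln (1 + x) \<le> x - x\<^sup>2 / 2 + ...\<close>. Any positive multiple of
  \<open>x\<^sup>2\<close> yields a gain of order \<open>1 / m\<close> in \<open>gap_at_one_neg\<close>; the constant \<open>1 / 4\<close> is good enough there
  from \<open>m = 5\<close> on.\<close>

lemma one_plus_le_exp_quadratic:
  fixes x :: real
  assumes "0 \<le> x" "x \<le> 1"
  shows "1 + x \<le> exp (x - x\<^sup>2 / 4)"
proof -
  have q: "0 \<le> x - x\<^sup>2 / 4" using assms by (simp add: power2_eq_square) (smt (verit) mult_left_le)
  have "3 / 4 \<le> 1 - x / 4" using assms by simp
  then have "(3 / 4)\<^sup>2 \<le> (1 - x / 4)\<^sup>2" by (intro power_mono) auto
  then have "1 / 2 \<le> (1 - x / 4)\<^sup>2" by (simp add: power2_eq_square)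
  then have "x\<^sup>2 * (1 / 2) \<le> x\<^sup>2 * (1 - x / 4)\<^sup>2" by (intro mult_left_mono) auto
  moreover have "x\<^sup>2 * (1 - x / 4)\<^sup>2 = (x - x\<^sup>2 / 4)\<^sup>2" by (simp add: power2_eq_square algebra_simps)
  ultimately have "1 + x \<le> 1 + (x - x\<^sup>2 / 4) + (x - x\<^sup>2 / 4)\<^sup>2 / 2" by simp
  also have "\<dots> \<le> exp (x - x\<^sup>2 / 4)" using q by (rule exp_lower_Taylor_quadratic)
  finally show ?thesis .
qed

text \<open>The power \<open>(1 + 1 / (2 m)) ^ m\<close> falls short of \<open>exp (1 / 2)\<close> by a factor \<open>exp (- y)\<close> with \<open>y\<close> of
  order \<open>1 / m\<close>, whereas the Taylor polynomial falls short of \<open>exp 1\<close> by a relative error of at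
  most \<open>p = 1 / m!\<close>. For \<open>m \<ge> 5\<close> the first loss is the larger one; \<open>m = 4\<close> is too tight for these
  estimates and is computed.\<close>

lemma gap_at_one_neg:
  assumes "4 \<le> m"
  shows "gap m 1 < 0"
proof (cases "m = 4")
  case True
  then show ?thesis using exp_half_less
    by (simp add: gap_def exp_sum_def eval_nat_numeral fact_numeral field_simps)
next
  case False
  then have m: "5 \<le> m" using assms by simp
  define y where "y = 1 / (16 * real m)"
  define p where "p = 1 / (fact m :: real)"
  have y: "0 < y" using m by (simp add: y_def)
  have "1 + 1 / (2 * real m) \<le> exp (1 / (2 * real m) - (1 / (2 * real m))\<^sup>2 / 4)"
    using m by (intro one_plus_le_exp_quadratic) auto
  then have "(1 + 1 / (2 * real m)) ^ m \<le> exp (1 / (2 * real m) - (1 / (2 * real m))\<^sup>2 / 4) ^ m"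
    by (intro power_mono) auto
  also have "\<dots> = exp (1 / 2 - y)"
    using m by (simp add: exp_of_nat_mult[symmetric] y_def field_simps power2_eq_square)
  also have "(1 + 1 / (2 * real m)) = (1 + m - 1 / 2) / m" using m by (simp add: field_simps)
  finally have "exp (1 / 2) * ((1 + m - 1 / 2) / m) ^ m \<le> exp (1 / 2) * exp (1 / 2 - y)"
    by (intro mult_left_mono) auto
  also have "\<dots> = exp 1 * exp (- y)" by (simp add: exp_add[symmetric])
  also have "\<dots> < exp 1 * (1 - p)"
  proof -
    (* Since m! = m (m - 1)! is at least 24 m, p is at most two thirds of y. *)
    have "fact 4 \<le> (fact (m - 1) :: real)" using m by (intro fact_mono) auto
    then have "real m * 24 \<le> real m * fact (m - 1)" using m by (intro mult_left_mono) (auto simp: fact_numeral)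
    also have "\<dots> = fact m" using m by (simp add: fact_reduce)
    finally have "p \<le> 1 / (real m * 24)" unfolding p_def using m by (intro divide_left_mono) auto
    also have "\<dots> = y * 2 / 3" by (simp add: y_def)
    finally have p: "p \<le> y * 2 / 3" .
    have "y \<le> 1 / 80" using m by (simp add: y_def field_simps)
    with p have "p \<le> 1 / 120" by simp
    then have "p * y \<le> 1 / 120 * y" using y by (intro mult_right_mono) auto
    with p y have "1 < 1 + y - p - p * y" by linarith
    also have "\<dots> = (1 - p) * (1 + y)" by (simp add: algebra_simps)
    also have "\<dots> \<le> (1 - p) * exp y" using \<open>p \<le> 1 / 120\<close> by (intro mult_left_mono) auto
    finally have "exp (- y) < 1 - p" by (simp add: exp_minus field_simps)
    then show ?thesis by simp
  qed
  also have "\<dots> \<le> exp_sum m 1"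
  proof -
    obtain t :: real where t: "\<bar>t\<bar> \<le> 1" "exp 1 = exp_sum m 1 + exp t / fact m"
      using Maclaurin_exp_le[of 1 m] by (auto simp: exp_sum_def)
    have "exp t / fact m \<le> exp 1 / fact m" using t(1) by (intro divide_right_mono) auto
    with t(2) have "exp 1 - exp 1 / fact m \<le> exp_sum m 1" by linarith
    then show ?thesis by (simp add: p_def right_diff_distrib)
  qed
  finally show ?thesis by (simp add: gap_def)
qed

text \<open>In \<open>u = x - 1 / 2\<close> every coefficient is positive. The closest one is the constant term for
  \<open>m = 3\<close>, where \<open>exp (1 / 2) > 13 / 8\<close> is needed; \<open>41 / 25\<close> is a lower bound of \<open>exp (1 / 2)\<close> that
  suffices throughout.\<close>

lemma gap_small_pos:
  assumes "m \<in> {1, 2, 3}" "1 / 2 < x"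
  shows "0 < gap m x"
proof -
  define u where "u = x - 1 / 2"
  have x: "x = u + 1 / 2" and u: "0 < u" using assms by (auto simp: u_def)
  have E: "41 / 25 < exp (1 / 2 :: real)"
    using exp_sum_less_exp[of "1 / 2" 4] by (simp add: exp_sum_def eval_nat_numeral fact_numeral)
  have u2: "0 < u\<^sup>2" "0 < u ^ 3" using u by auto
  consider "m = 1" | "m = 2" | "m = 3" using assms by auto
  then show ?thesis
  proof cases
    case 1
    have "1 * 1 < exp (1 / 2) * (u + 1)" using E u by (intro mult_strict_mono) auto
    then show ?thesis by (simp add: 1 gap_def exp_sum_def x add.commute)
  next
    case 2
    have "41 / 25 * (1 + u / 2)\<^sup>2 - (3 / 2 + u) = 7 / 50 + 16 / 25 * u + 41 / 100 * u\<^sup>2"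
      by (simp add: power2_eq_square field_simps)
    then have "3 / 2 + u < 41 / 25 * (1 + u / 2)\<^sup>2" using u u2 by linarith
    also have "\<dots> < exp (1 / 2) * (1 + u / 2)\<^sup>2" using E u by (intro mult_strict_right_mono) auto
    also have "1 + u / 2 = (x + real m - 1 / 2) / real m" by (simp add: 2 x field_simps)
    also have "3 / 2 + u = exp_sum m x" by (simp add: 2 x exp_sum_def eval_nat_numeral)
    finally show ?thesis by (simp add: 2 gap_def)
  next
    case 3
    have "41 / 25 * (1 + u / 3) ^ 3 - (13 / 8 + 3 / 2 * u + u\<^sup>2 / 2)
        = 3 / 200 + 7 / 50 * u + 7 / 150 * u\<^sup>2 + 41 / 675 * u ^ 3"
      by (simp add: power2_eq_square power3_eq_cube field_simps)
    then have "13 / 8 + 3 / 2 * u + u\<^sup>2 / 2 < 41 / 25 * (1 + u / 3) ^ 3" using u u2 by linarith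
    also have "\<dots> < exp (1 / 2) * (1 + u / 3) ^ 3" using E u by (intro mult_strict_right_mono) auto
    also have "1 + u / 3 = (x + real m - 1 / 2) / real m" by (simp add: 3 x field_simps)
    also have "13 / 8 + 3 / 2 * u + u\<^sup>2 / 2 = exp_sum m x"
      by (simp add: 3 x exp_sum_def eval_nat_numeral field_simps)
    finally show ?thesis by (simp add: 3 gap_def)
  qed
qed

lemma open_interval_eq_Inf_Sup:
  fixes U :: "real set"
  assumes "open U" "is_interval U" "bounded U" "U \<noteq> {}"
  shows "U = {Inf U <..< Sup U}"
proof (intro equalityI subsetI)
  have bb: "bdd_below U" "bdd_above U" using \<open>bounded U\<close>
    by (auto intro: bounded_imp_bdd_below bounded_imp_bdd_above)
  fix x assume "x \<in> U"
  then obtain e where e: "0 < e" "cball x e \<subseteq> U" using \<open>open U\<close> open_contains_cball by blast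
  then have "x - e \<in> U" "x + e \<in> U" by (auto simp: dist_real_def subset_iff)
  with e bb show "x \<in> {Inf U <..< Sup U}"
    using cInf_lower[of "x - e" U] cSup_upper[of "x + e" U] by auto
next
  have bb: "bdd_below U" "bdd_above U" using \<open>bounded U\<close>
    by (auto intro: bounded_imp_bdd_below bounded_imp_bdd_above)
  fix x assume "x \<in> {Inf U <..< Sup U}"
  then obtain a b where "a \<in> U" "b \<in> U" "a < x" "x < b"
    using bb \<open>U \<noteq> {}\<close> by (auto simp: cInf_less_iff less_cSup_iff)
  then show "x \<in> U" using \<open>is_interval U\<close> by (meson is_interval_1 less_imp_le)
qed

lemma isCont_gap: "isCont (gap m) x"
  unfolding gap_def[abs_def] exp_sum_def by (cases "m = 0") (auto intro!: continuous_intros)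

text \<open>The endpoints are the infimum and the supremum of the set of \<open>s > 0\<close> with negative gap. It is open,
  so it contains neither of them and 1 lies strictly between them.\<close>

lemma gap_neg_interval:
  assumes "4 \<le> m"
  obtains r r' where "0 < r" "r < 1" "1 < r'"
    "\<And>s. 0 < s \<Longrightarrow> gap m ((1 + s) / 2) < 0 \<longleftrightarrow> r < s \<and> s < r'"
proof -
  define U where "U = {s. 0 < s \<and> gap m ((1 + s) / 2) < 0}"
  have cont: "isCont (\<lambda>s. gap m ((1 + s) / 2)) s" for s
    by (rule isCont_o2[OF _ isCont_gap]) (auto intro!: continuous_intros)
  have "open U"
    unfolding U_def using cont
    by (intro open_Collect_conj open_Collect_less continuous_intros) (auto simp: continuous_at_imp_continuous_on)
  have "1 \<in> U" using gap_at_one_neg[OF assms] by (simp add: U_def)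
  have "is_interval U"
    unfolding is_interval_1
  proof (intro ballI allI impI)
    fix a d b assume "a \<in> U" "d \<in> U" "a \<le> b \<and> b \<le> d"
    then show "b \<in> U"
      using gap_neg_between[of m "(1 + a) / 2" "(1 + b) / 2" "(1 + d) / 2"] assms
      by (cases "b = a \<or> b = d") (auto simp: U_def)
  qed
  define K where "K = 2 * (exp 1 * real m ^ m)"
  have "s \<le> K" if "s \<in> U" for s
    using gap_nonneg_far[of m "(1 + s) / 2"] that assms by (force simp: U_def K_def)
  moreover obtain \<delta> where \<delta>: "0 < \<delta>" "\<And>s. s \<in> U \<Longrightarrow> \<delta> \<le> s"
  proof -
    (* The gap is still positive at s = 0, so by continuity also near 0. *)
    have "0 < gap m ((1 + 0) / 2)" using gap_at_half_pos[of m] assms by simp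
    then have "eventually (\<lambda>s. 0 < gap m ((1 + s) / 2)) (nhds 0)"
      using cont[of 0] by (intro order_tendstoD(1)[where y = "gap m ((1 + 0) / 2)"])
        (simp_all only: isCont_def tendsto_at_iff_tendsto_nhds[where g = "\<lambda>s. gap m ((1 + s) / 2)"])
    then obtain \<delta> where "0 < \<delta>" and near: "\<And>s. dist s 0 < \<delta> \<Longrightarrow> 0 < gap m ((1 + s) / 2)"
      by (auto simp: eventually_nhds_metric)
    show thesis
    proof (rule that[OF \<open>0 < \<delta>\<close>])
      fix s assume "s \<in> U"
      then have "0 < s" "gap m ((1 + s) / 2) < 0" by (auto simp: U_def)
      with near[of s] show "\<delta> \<le> s" by (force simp: dist_real_def not_le[symmetric])
    qed
  qed
  ultimately have "U \<subseteq> {\<delta>..K}" by auto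
  then have "bounded U" by (meson bounded_closed_interval bounded_subset)
  define r where "r = Inf U"
  define r' where "r' = Sup U"
  have U: "U = {r <..< r'}"
    unfolding r_def r'_def using \<open>open U\<close> \<open>is_interval U\<close> \<open>bounded U\<close> \<open>1 \<in> U\<close>
    by (intro open_interval_eq_Inf_Sup) auto
  have "\<delta> \<le> r" unfolding r_def using \<open>1 \<in> U\<close> \<delta> by (intro cInf_greatest) auto
  show thesis
  proof
    show "0 < r" using \<open>\<delta> \<le> r\<close> \<delta>(1) by simp
    show "r < 1" "1 < r'" using \<open>1 \<in> U\<close> by (simp_all add: U)
    show "gap m ((1 + s) / 2) < 0 \<longleftrightarrow> r < s \<and> s < r'" if "0 < s" for s
    proof -
      have "s \<in> U \<longleftrightarrow> r < s \<and> s < r'" by (simp add: U)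
      with that show ?thesis by (simp add: U_def)
    qed
  qed
qed

section \<open>Comparison of the two bounds\<close>

lemma op_norm_pos:
  fixes A :: "real ^ 'n ^ 'n"
  assumes "positive_definite A"
  shows "0 < op_norm A"
proof -
  have "axis undefined 1 \<noteq> (0 :: real ^ 'n)" by (simp add: axis_eq_0_iff)
  then have "axis undefined 1 \<bullet> (A *v axis undefined 1) > 0"
    using assms unfolding positive_definite_def by blast
  then have "A *v axis undefined 1 \<noteq> 0" by auto
  then show ?thesis by (auto simp: op_norm_def onorm_pos_lt)
qed


lemma bounds_difference:
  assumes "0 < m" "0 < s"
  shows "(1 + s / real (2 * m)) powr (real (2 * m) / 2) * exp (- (s / 2)) - (1 - chi_square_cdf (2 * m) (1 + s))
    = exp (- ((1 + s) / 2)) * gap m ((1 + s) / 2)"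
proof -
  have "1 + s / real (2 * m) = ((1 + s) / 2 + m - 1 / 2) / m"
    using assms by (simp add: field_simps)
  moreover have "(1 + s / real (2 * m)) powr (real (2 * m) / 2) = (1 + s / real (2 * m)) ^ m"
    using assms by (simp add: powr_realpow add_pos_pos)
  moreover have "exp (- (s / 2)) = exp (- ((1 + s) / 2)) * exp (1 / 2)"
    by (simp add: exp_add[symmetric] field_simps)
  moreover have "1 - chi_square_cdf (2 * m) (1 + s) = exp (- ((1 + s) / 2)) * exp_sum m ((1 + s) / 2)"
    unfolding minus_divide_left using assms by (intro chi_square_tail) simp
  ultimately show ?thesis by (simp only: gap_def right_diff_distrib mult_ac)
qed

theorem proposition5:
  fixes n :: nat
  assumes "n = CARD('n::finite)" and "n \<ge> 2" and "even n"
  shows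
    "(n \<in> {2, 4, 6} \<longrightarrow>
       (\<forall>(A :: real ^ 'n ^ 'n) t. positive_definite A \<and> t > 0 \<longrightarrow>
          1 - chi_square_cdf n (1 + t / op_norm A)
            < (1 + t / (real n * op_norm A)) powr (real n / 2) * exp (- (t / (2 * op_norm A))))) \<and>
     (n \<ge> 8 \<longrightarrow>
       (\<exists>r r' :: real. 0 < r \<and> r < 1 \<and> 1 < r' \<and>
          (\<forall>(A :: real ^ 'n ^ 'n) t. positive_definite A \<and> t > 0 \<longrightarrow>
             ((1 + t / (real n * op_norm A)) powr (real n / 2) * exp (- (t / (2 * op_norm A)))
                < 1 - chi_square_cdf n (1 + t / op_norm A)
              \<longleftrightarrow> r < t / op_norm A \<and> t / op_norm A < r'))))"
proof -
  obtain m where n: "n = 2 * m" using \<open>even n\<close> by blast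
  with \<open>n \<ge> 2\<close> have m: "0 < m" by simp
  have diff: "0 < t / op_norm A \<and>
      (1 + t / (real n * op_norm A)) powr (real n / 2) * exp (- (t / (2 * op_norm A)))
        - (1 - chi_square_cdf n (1 + t / op_norm A))
      = exp (- ((1 + t / op_norm A) / 2)) * gap m ((1 + t / op_norm A) / 2)"
    if "positive_definite A \<and> t > 0" for A :: "real ^ 'n ^ 'n" and t
  proof -
    have pos: "0 < t / op_norm A" using that op_norm_pos[of A] by simp
    have "t / (real n * op_norm A) = t / op_norm A / real n" "t / (2 * op_norm A) = t / op_norm A / 2"
      by (simp_all add: mult.commute)
    with pos bounds_difference[OF m pos] show ?thesis by (simp only: n)
  qed
  show ?thesis
  proof (intro conjI impI)
    assume "n \<in> {2, 4, 6}"
    then have small: "m \<in> {1, 2, 3}" using n by auto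
    show "\<forall>(A :: real ^ 'n ^ 'n) t. positive_definite A \<and> t > 0 \<longrightarrow>
          1 - chi_square_cdf n (1 + t / op_norm A)
            < (1 + t / (real n * op_norm A)) powr (real n / 2) * exp (- (t / (2 * op_norm A)))"
    proof (intro allI impI)
      fix A :: "real ^ 'n ^ 'n" and t :: real
      assume "positive_definite A \<and> t > 0"
      note d = diff[OF this]
      then have "0 < gap m ((1 + t / op_norm A) / 2)" by (intro gap_small_pos small) simp
      then have "0 < exp (- ((1 + t / op_norm A) / 2)) * gap m ((1 + t / op_norm A) / 2)" by simp
      with d show "1 - chi_square_cdf n (1 + t / op_norm A)
            < (1 + t / (real n * op_norm A)) powr (real n / 2) * exp (- (t / (2 * op_norm A)))"
        by linarith
    qed
  next
    assume "n \<ge> 8"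
    then have "4 \<le> m" using n by simp
    then obtain r r' where r: "0 < r" "r < 1" "1 < r'"
      and iff: "\<And>s. 0 < s \<Longrightarrow> gap m ((1 + s) / 2) < 0 \<longleftrightarrow> r < s \<and> s < r'"
      using gap_neg_interval by blast
    have "(1 + t / (real n * op_norm A)) powr (real n / 2) * exp (- (t / (2 * op_norm A)))
                < 1 - chi_square_cdf n (1 + t / op_norm A)
              \<longleftrightarrow> r < t / op_norm A \<and> t / op_norm A < r'"
      if "positive_definite A \<and> t > 0" for A :: "real ^ 'n ^ 'n" and t
    proof -
      note d = diff[OF that]
      have "(1 + t / (real n * op_norm A)) powr (real n / 2) * exp (- (t / (2 * op_norm A)))
                < 1 - chi_square_cdf n (1 + t / op_norm A)
          \<longleftrightarrow> exp (- ((1 + t / op_norm A) / 2)) * gap m ((1 + t / op_norm A) / 2) < 0"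
        using d by linarith
      also have "\<dots> \<longleftrightarrow> gap m ((1 + t / op_norm A) / 2) < 0" by (simp add: mult_less_0_iff)
      also have "\<dots> \<longleftrightarrow> r < t / op_norm A \<and> t / op_norm A < r'" using d by (intro iff) simp
      finally show ?thesis .
    qed
    with r show "\<exists>r r' :: real. 0 < r \<and> r < 1 \<and> 1 < r' \<and>
          (\<forall>(A :: real ^ 'n ^ 'n) t. positive_definite A \<and> t > 0 \<longrightarrow>
             ((1 + t / (real n * op_norm A)) powr (real n / 2) * exp (- (t / (2 * op_norm A)))
                < 1 - chi_square_cdf n (1 + t / op_norm A)
              \<longleftrightarrow> r < t / op_norm A \<and> t / op_norm A < r'))"
      by blast
  qed
qed

end
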